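(* Let $G$ be a finite group and let $\chi$ be a virtual character of $G$. Then $\chi$ is an integer-valued character if and only if $E_{Nr}(\lambda_t(\chi))\in Nr(CF(G))$ has finite support.
   Context: $CF(G)$ is the commutative $\mathbb{C}$-algebra of class functions $f:G\to\mathbb{C}$ with pointwise operations. A virtual character of $G$ is a $\mathbb{Z}$-linear combination of irreducible complex characters of $G$; it is called an integer-valued character if $\chi(g)\in\mathbb{Z}$ for all $g\in G$. $CF(G)$ carries the $\lambda$-ring structure whose $n$-th Adams operation is $\psi^n(f)(g)=f(g^n)$; explicitly, $\lambda_t(f)=\sum_{i\ge0}\lambda^i(f)t^i=\exp\big(-\sum_{i\ge1}\frac{\psi^i(f)}{i}(-t)^i\big)\in CF(G)[[t]]$. For a commutative ring $R$, $\Lambda(R)=1+tR[[t]]$, and the necklace ring $Nr(R)$ is the set of infinite vectors $(x_1,x_2,x_3,\ldots)$ with entries in $R$, with componentwise addition and multiplication $(x\cdot_{Nr}y)_n=\sum_{[i,j]=n}(i,j)x_iy_j$, where $(i,j)$ and $[i,j]$ denote gcd and lcm. For $R=CF(G)$ (a $\mathbb{Q}$-algebra), each $f\in\Lambda(R)$ can be written uniquely as $f(t)=\prod_{i\ge1}(1-(-t)^i)^{a_i}$ with $a_i\in R$, where $(1-u)^{a}=\sum_{k\ge0}(-1)^k\binom{a}{k}u^k$ and $\binom{a}{k}=a(a-1)\cdots(a-k+1)/k!$; one puts $E_{Nr}(f)=(a_1,a_2,a_3,\ldots)\in Nr(R)$. An element $x=(x_1,x_2,\ldots)\in Nr(R)$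 has finite support if the set of integers $n\ge1$ with $x_n\neq0$ is finite. *)

theory Defs
  imports
    "HOL-Library.Function_Algebras"
    "HOL-Computational_Algebra.Formal_Power_Series"
    "HOL-Algebra.Group"
    "Jordan_Normal_Form.VS_Connect"
begin

section \<open>Class functions\<close>

text \<open>
  A function on the carrier of \<open>G\<close> is stored as a total function whose value at every point
  outside the carrier is its value at the identity.  With this convention (in contrast to
  extension by 0) the class functions form a subalgebra of the algebra of all functions
  \<open>'a \<Rightarrow> complex\<close> containing the constants, so the ring operations, the unit, and formal power
  series over \<open>CF(G)\<close> are those of the library's pointwise ring structure on functions.
\<close>

definition extend_fun :: "('a, 'b) monoid_scheme \<Rightarrow> ('a \<Rightarrow> complex) \<Rightarrow> 'a \<Rightarrow> complex" where
  "extend_fun G f = (\<lambda>x. if x \<in> carrier G then f x else f \<one>\<^bsub>G\<^esub>)"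

definition class_functions :: "('a, 'b) monoid_scheme \<Rightarrow> ('a \<Rightarrow> complex) set" where
  "class_functions G =
     {f. (\<forall>g\<in>carrier G. \<forall>h\<in>carrier G. f (h \<otimes>\<^bsub>G\<^esub> g \<otimes>\<^bsub>G\<^esub> inv\<^bsub>G\<^esub> h) = f g) \<and>
         (\<forall>x. x \<notin> carrier G \<longrightarrow> f x = f \<one>\<^bsub>G\<^esub>)}"

lemma class_functions_subring:
  assumes "f \<in> class_functions G" "g \<in> class_functions G"
  shows "(\<lambda>_. c) \<in> class_functions G" "0 \<in> class_functions G" "1 \<in> class_functions G"
    "f + g \<in> class_functions G" "- f \<in> class_functions G" "f * g \<in> class_functions G"
  using assms by (auto simp: class_functions_def)


section \<open>Irreducible and virtual characters\<close>

definition GL :: "nat \<Rightarrow> complex mat monoid" where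
  "GL n = units_of (ring_mat TYPE(complex) n ())"

definition mat_trace :: "complex mat \<Rightarrow> complex" where
  "mat_trace A = (\<Sum>i<dim_row A. A $$ (i, i))"

definition irreducible_rep ::
    "('a, 'b) monoid_scheme \<Rightarrow> nat \<Rightarrow> ('a \<Rightarrow> complex mat) \<Rightarrow> bool" where
  "irreducible_rep G n \<rho> \<longleftrightarrow>
     \<rho> \<in> hom G (GL n) \<and> n > 0 \<and>
     (\<forall>W. subspace class_ring W (module_vec TYPE(complex) n) \<longrightarrow>
          (\<forall>g\<in>carrier G. \<forall>w\<in>W. \<rho> g *\<^sub>v w \<in> W) \<longrightarrow>
          W = {0\<^sub>v n} \<or> W = carrier_vec n)"

definition irreducible_characters :: "('a, 'b) monoid_scheme \<Rightarrow> ('a \<Rightarrow> complex) set" where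
  "irreducible_characters G =
     {extend_fun G (\<lambda>g. mat_trace (\<rho> g)) | n \<rho>. irreducible_rep G n \<rho>}"

definition virtual_characters :: "('a, 'b) monoid_scheme \<Rightarrow> ('a \<Rightarrow> complex) set" where
  "virtual_characters G =
     {(\<lambda>g. \<Sum>\<phi>\<in>S. of_int (c \<phi>) * \<phi> g) | S (c :: ('a \<Rightarrow> complex) \<Rightarrow> int).
        finite S \<and> S \<subseteq> irreducible_characters G}"

definition integer_valued_character :: "('a, 'b) monoid_scheme \<Rightarrow> ('a \<Rightarrow> complex) \<Rightarrow> bool" where
  "integer_valued_character G \<chi> \<longleftrightarrow>
     \<chi> \<in> virtual_characters G \<and> (\<forall>g\<in>carrier G. \<chi> g \<in> \<int>)"


section \<open>The \<open>\<lambda>\<close>-ring structure on class functions\<close>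

definition adams :: "('a, 'b) monoid_scheme \<Rightarrow> nat \<Rightarrow> ('a \<Rightarrow> complex) \<Rightarrow> 'a \<Rightarrow> complex" where
  "adams G n f = extend_fun G (\<lambda>g. f (g [^]\<^bsub>G\<^esub> n))"

text \<open>
  Substitution of \<open>F\<close> into the exponential series; meaningful when \<open>F\<close> has constant term 0.
  (The library's \<open>fps_exp\<close> requires a field of coefficients.)
\<close>

definition exp_series :: "('a \<Rightarrow> complex) fps \<Rightarrow> ('a \<Rightarrow> complex) fps" where
  "exp_series F = fps_compose (Abs_fps (\<lambda>k _. 1 / fact k)) F"

definition lambda_t :: "('a, 'b) monoid_scheme \<Rightarrow> ('a \<Rightarrow> complex) \<Rightarrow> ('a \<Rightarrow> complex) fps" where
  "lambda_t G f =
     exp_series (- Abs_fps (\<lambda>i. if i = 0 then 0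
                                else (\<lambda>g. adams G i f g / of_nat i * (-1) ^ i)))"


section \<open>The necklace ring\<close>

text \<open>
  The ring of coefficients is a subring \<open>R\<close> of the ring of a type.  A vector
  \<open>(x\<^sub>1, x\<^sub>2, \<dots>)\<close> is a function on \<open>nat\<close> whose unused entry at 0 is 0.
\<close>

definition necklace_ring :: "'r::comm_ring_1 set \<Rightarrow> (nat \<Rightarrow> 'r) ring" where
  "necklace_ring R =
     \<lparr>carrier = {x. x 0 = 0 \<and> (\<forall>n\<ge>1. x n \<in> R)},
      mult = (\<lambda>x y n. \<Sum>(i, j) | i \<ge> 1 \<and> j \<ge> 1 \<and> lcm i j = n. of_nat (gcd i j) * x i * y j),
      one = (\<lambda>n. if n = 1 then 1 else 0),
      zero = (\<lambda>n. 0),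
      add = (\<lambda>x y n. x n + y n)\<rparr>"

definition finite_support :: "(nat \<Rightarrow> 'r::zero) \<Rightarrow> bool" where
  "finite_support x \<longleftrightarrow> finite {n. n \<ge> 1 \<and> x n \<noteq> 0}"

text \<open>
  \<open>one_minus_powr u a\<close> is \<open>(1 - u)\<^sup>a = (\<Sum>k. (-1)\<^sup>k (a choose k) u\<^sup>k)\<close> for a series \<open>u\<close> with constant
  term 0.  The binomial coefficient of a function is formed pointwise, as are the ring
  operations in its definition.
\<close>

definition one_minus_powr ::
    "('a \<Rightarrow> complex) fps \<Rightarrow> ('a \<Rightarrow> complex) \<Rightarrow> ('a \<Rightarrow> complex) fps" where
  "one_minus_powr u a = fps_compose (Abs_fps (\<lambda>k g. (-1) ^ k * (a g gchoose k))) u"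

text \<open>The infinite product is the limit in the library's (\<open>t\<close>-adic) topology on power series.\<close>

definition E_Nr :: "('a \<Rightarrow> complex) set \<Rightarrow> ('a \<Rightarrow> complex) fps \<Rightarrow> nat \<Rightarrow> 'a \<Rightarrow> complex" where
  "E_Nr R f =
     (THE a. a \<in> carrier (necklace_ring R) \<and>
             (\<lambda>n. \<Prod>i=1..n. one_minus_powr ((- fps_X) ^ i) (a i)) \<longlonglongrightarrow> f)"

end

theory Submission
  imports
    Defs
    "HOL-Number_Theory.Residues"
    "Jordan_Normal_Form.Schur_Decomposition"
begin

text \<open>
  Write \<open>s(n) = \<chi>(g\<^sup>n)\<close>.  Comparing logarithmic derivatives in \<open>t\<close>, the exponents \<open>a\<^sub>n\<close> of
  \<open>\<lambda>\<^sub>t(\<chi>)\<close> at \<open>g\<close> are determined by \<open>s(n) = (\<Sum>d | n. d a\<^sub>d)\<close>, and \<open>s\<close> is an integral combination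
  of sequences \<open>z\<^sup>n\<close> with \<open>z\<^sup>m = 1\<close>, \<open>m = |G|\<close>.

  If \<open>s\<close> is integer-valued, the Frobenius congruence \<open>s(pn) \<equiv> s(n)\<^sup>p\<close> modulo \<open>p\<close> and boundedness give
  \<open>s(pn) = s(n)\<close> for all large primes \<open>p\<close>.  Every residue coprime to a modulus is represented by
  a number with only large prime factors, so \<open>s(n) = s(gcd(n, m))\<close>, and hence \<open>a\<^sub>n = 0\<close> unless
  \<open>n\<close> divides \<open>m\<close>.  This replaces Galois conjugation and the irreducibility of cyclotomic polynomials.

  Conversely, if \<open>a\<^sub>d = 0\<close> for \<open>d > N\<close>, the Fourier coefficient of \<open>s\<close> over the period \<open>m N!\<close> at a
  primitive \<open>e\<close>-th root of unity is \<open>(\<Sum>d \<le> N, e | d. a\<^sub>d)\<close>.  It is an integer, so all \<open>a\<^sub>e\<close> are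
  integers by downward induction on \<open>e\<close>, and \<open>\<chi>(g) = a\<^sub>1\<close>.
\<close>

section \<open>Integral combinations of powers of roots of unity\<close>

text \<open>The additive group generated by the sequences \<open>z ^ n\<close> with
  \<open>z ^ m = 1\<close>, built up one signed root at a time so that linear facts follow by rule
  induction. Whole sequences are tracked, not single values, because both \<open>n -> p * n\<close>
  and averaging over a period act on the index. For \<open>m = 0\<close> every \<open>z\<close>
  qualifies, hence the separate positivity assumptions later.\<close>

inductive unity_sum :: "nat \<Rightarrow> (nat \<Rightarrow> complex) \<Rightarrow> bool" for m where
  zero: "unity_sum m (\<lambda>_. 0)"
| add_power: "unity_sum m f \<Longrightarrow> z ^ m = 1 \<Longrightarrow> unity_sum m (\<lambda>n. f n + z ^ n)"
| diff_power: "unity_sum m f \<Longrightarrow> z ^ m = 1 \<Longrightarrow> unity_sum m (\<lambda>n. f n - z ^ n)"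

lemma unity_sum_power: "z ^ m = 1 \<Longrightarrow> unity_sum m (\<lambda>n. z ^ n)"
  using unity_sum.add_power[OF unity_sum.zero] by simp

lemma unity_sum_add:
  assumes "unity_sum m f" "unity_sum m g"
  shows "unity_sum m (\<lambda>n. f n + g n)"
  using assms(2,1)
  by induction (auto simp: add_diff_eq add.assoc[symmetric] intro: unity_sum.intros)

lemma unity_sum_diff:
  assumes "unity_sum m f" "unity_sum m g"
  shows "unity_sum m (\<lambda>n. f n - g n)"
  using assms(2,1)
proof induction
  case (add_power g z)
  then have "unity_sum m (\<lambda>n. (f n - g n) - z ^ n)" by (intro unity_sum.intros) auto
  then show ?case by (simp add: algebra_simps)
next
  case (diff_power g z)
  then have "unity_sum m (\<lambda>n. (f n - g n) + z ^ n)" by (intro unity_sum.intros) auto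
  then show ?case by (simp add: algebra_simps)
qed simp

lemma unity_sum_mult_power:
  assumes "unity_sum m f" "w ^ m = 1"
  shows "unity_sum m (\<lambda>n. f n * w ^ n)"
  using assms
proof induction
  case (add_power f z)
  then have "unity_sum m (\<lambda>n. f n * w ^ n + (z * w) ^ n)"
    by (intro unity_sum.intros) (auto simp: power_mult_distrib)
  then show ?case by (simp add: algebra_simps power_mult_distrib)
next
  case (diff_power f z)
  then have "unity_sum m (\<lambda>n. f n * w ^ n - (z * w) ^ n)"
    by (intro unity_sum.intros) (auto simp: power_mult_distrib)
  then show ?case by (simp add: algebra_simps power_mult_distrib)
qed (simp add: unity_sum.zero)

lemma unity_sum_mult:
  assumes "unity_sum m f" "unity_sum m g"
  shows "unity_sum m (\<lambda>n. f n * g n)"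
  using assms(2,1)
  by induction
    (auto simp: distrib_left right_diff_distrib
          intro: unity_sum.zero unity_sum_add unity_sum_diff unity_sum_mult_power)

lemma unity_sum_pow: "unity_sum m f \<Longrightarrow> unity_sum m (\<lambda>n. f n ^ k)"
  by (induction k) (use unity_sum_power[of 1 m] in \<open>auto intro: unity_sum_mult\<close>)

lemma unity_sum_of_nat: "unity_sum m (\<lambda>_. of_nat k)"
proof (induction k)
  case (Suc k)
  then show ?case using unity_sum.add_power[OF Suc, of 1] by (simp add: add.commute)
qed (simp add: unity_sum.zero)

lemma unity_sum_of_int: "unity_sum m (\<lambda>_. of_int k)"
proof (cases k rule: int_cases2)
  case (nonpos n)
  then show ?thesis using unity_sum_diff[OF unity_sum.zero unity_sum_of_nat[of m n]] by simp
qed (simp add: unity_sum_of_nat)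

lemma unity_sum_sum:
  "(\<And>i. i \<in> S \<Longrightarrow> unity_sum m (f i)) \<Longrightarrow> unity_sum m (\<lambda>n. \<Sum>i\<in>S. f i n)"
  by (induction S rule: infinite_finite_induct) (auto intro: unity_sum.zero unity_sum_add)

lemma unity_sum_dvd:
  assumes "unity_sum m f" "m dvd M"
  shows "unity_sum M f"
  using assms by induction (auto intro!: unity_sum.intros elim!: dvdE simp: power_mult)

lemma unity_sum_periodic:
  assumes "unity_sum m f"
  shows "f (n + m * k) = f n"
  using assms by induction (auto simp: power_add power_mult)

lemma unity_sum_cong:
  assumes "unity_sum m f" "[a = b] (mod m)"
  shows "f a = f b"
proof -
  have "f x = f (x mod m)" for x
    using unity_sum_periodic[OF assms(1), of "x mod m" "x div m"] by simp
  then show ?thesis using assms(2) by (metis cong_def)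
qed

section \<open>Bounds and averages over a period\<close>

lemma norm_root_of_unity:
  fixes z :: "'b::real_normed_div_algebra"
  assumes "z ^ m = 1" "m > 0"
  shows "norm z = 1"
  using assms by (metis norm_ge_zero norm_one norm_power power_eq_imp_eq_base power_one zero_le_one)

lemma unity_sum_bounded:
  assumes "unity_sum m f" "m > 0"
  shows "\<exists>C. \<forall>n. norm (f n) \<le> C"
  using assms
proof induction
  case (add_power f z)
  then obtain C where C: "\<And>n. norm (f n) \<le> C" by auto
  have "norm z = 1" using add_power norm_root_of_unity by blast
  then have "norm (f n + z ^ n) \<le> C + 1" for n
    using norm_triangle_ineq[of "f n" "z ^ n"] C[of n] by (simp add: norm_power)
  then show ?case by blast
next
  case (diff_power f z)
  then obtain C where C: "\<And>n. norm (f n) \<le> C" by auto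
  have "norm z = 1" using diff_power norm_root_of_unity by blast
  then have "norm (f n - z ^ n) \<le> C + 1" for n
    using norm_triangle_ineq4[of "f n" "z ^ n"] C[of n] by (simp add: norm_power)
  then show ?case by blast
qed auto

lemma sum_powers_root_of_unity:
  fixes z :: complex
  assumes "z ^ m = 1"
  shows "(\<Sum>n<m. z ^ n) = (if z = 1 then of_nat m else 0)"
  using assms by (simp add: sum_gp_strict)

text \<open>Orthogonality: a root \<open>z\<close> other than 1 sums to 0 over a period and
  \<open>z = 1\<close> sums to \<open>m\<close>, so \<open>c\<close> is the signed multiplicity of
  the root 1.\<close>

lemma unity_sum_sum_period:
  assumes "unity_sum m f"
  shows "\<exists>c::int. (\<Sum>n<m. f n) = of_nat m * of_int c"
  using assms
proof induction
  case zero
  then show ?case by (auto intro: exI[of _ 0])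
next
  case (add_power f z)
  then obtain c :: int where "(\<Sum>n<m. f n) = of_nat m * of_int c" by blast
  then show ?case using add_power(2)
    by (intro exI[of _ "c + (if z = 1 then 1 else 0)"])
       (simp add: sum.distrib sum_powers_root_of_unity algebra_simps)
next
  case (diff_power f z)
  then obtain c :: int where "(\<Sum>n<m. f n) = of_nat m * of_int c" by blast
  then show ?case using diff_power(2)
    by (intro exI[of _ "c - (if z = 1 then 1 else 0)"])
       (simp add: sum_subtractf sum_powers_root_of_unity algebra_simps)
qed

section \<open>The Frobenius congruence modulo a prime\<close>

text \<open>The inner binomials are divisible by \<open>p\<close>, so \<open>div\<close> is exact.
  The remainder is spelled out because it must later be recognised as a \<open>unity_sum\<close>
  itself.\<close>

lemma prime_power_add:
  fixes a b :: "'a::comm_semiring_1"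
  assumes "prime p"
  shows "(a + b) ^ p =
    a ^ p + b ^ p + of_nat p * (\<Sum>k\<in>{1..<p}. of_nat ((p choose k) div p) * a ^ k * b ^ (p - k))"
proof -
  have p: "p > 1" using assms prime_gt_1_nat by blast
  then have "{..p} = insert 0 (insert p {1..<p})" by auto
  then have "(a + b) ^ p = a ^ p + b ^ p + (\<Sum>k\<in>{1..<p}. of_nat (p choose k) * a ^ k * b ^ (p - k))"
    using p by (simp add: binomial_ring algebra_simps)
  also have "(\<Sum>k\<in>{1..<p}. of_nat (p choose k) * a ^ k * b ^ (p - k)) =
      of_nat p * (\<Sum>k\<in>{1..<p}. of_nat ((p choose k) div p) * a ^ k * b ^ (p - k))"
    unfolding sum_distrib_left
  proof (rule sum.cong[OF refl])
    fix k assume "k \<in> {1..<p}"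
    then have "p dvd p choose k" using assms by (intro dvd_choose_prime) auto
    then have "p choose k = p * ((p choose k) div p)" by simp
    then have "(of_nat (p choose k) :: 'a) = of_nat p * of_nat ((p choose k) div p)" by (metis of_nat_mult)
    then show "of_nat (p choose k) * a ^ k * b ^ (p - k) =
        of_nat p * (of_nat ((p choose k) div p) * a ^ k * b ^ (p - k))"
      by (simp add: mult.assoc)
  qed
  finally show ?thesis .
qed

text \<open>A single power satisfies \<open>z ^ (p * n) = (z ^ n) ^ p\<close> exactly; each further
  root only adds the cross terms of a binomial expansion, which go into \<open>h\<close>. The sign
  \<open>e\<close> treats addition and subtraction together, and oddness of \<open>p\<close> gives
  \<open>e ^ p = e\<close>.\<close>

lemma unity_sum_frobenius:
  assumes "unity_sum m f" "prime p" "odd p"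
  shows "\<exists>h. unity_sum m h \<and> (\<forall>n. f (p * n) = f n ^ p + of_nat p * h n)"
proof -
  have step: "\<exists>h. unity_sum m h \<and> (\<forall>n. f (p * n) + e * z ^ (p * n) = (f n + e * z ^ n) ^ p + of_nat p * h n)"
    if "unity_sum m f" "unity_sum m h" "\<And>n. f (p * n) = f n ^ p + of_nat p * h n" "z ^ m = 1"
      "e = 1 \<or> e = - 1" for f h z e
  proof -
    let ?g = "\<lambda>n. \<Sum>k\<in>{1..<p}. of_nat ((p choose k) div p) * f n ^ k * (e * z ^ n) ^ (p - k)"
    have "unity_sum m (\<lambda>n. e)" using that(5) unity_sum_of_int[of m 1] unity_sum_of_int[of m "-1"] by auto
    then have "unity_sum m ?g"
      using that by (intro unity_sum_sum unity_sum_mult unity_sum_pow unity_sum_of_nat unity_sum_power)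
    moreover have "e ^ p = e" using that(5) \<open>odd p\<close> by auto
    then have "f (p * n) + e * z ^ (p * n) = (f n + e * z ^ n) ^ p + of_nat p * (h n - ?g n)" for n
      unfolding prime_power_add[OF assms(2)] that(3)
      by (simp add: power_mult_distrib power_mult[symmetric] mult.commute[of p n] algebra_simps del: sum_distrib_left)
    ultimately show ?thesis using unity_sum_diff[OF that(2)] by blast
  qed
  show ?thesis using assms(1)
  proof induction
    case zero
    then show ?case using assms(2) by (intro exI[of _ "\<lambda>_. 0"]) (auto simp: unity_sum.zero prime_gt_0_nat)
  next
    case (add_power f z)
    then show ?case using step[of f _ z 1] by auto
  next
    case (diff_power f z)
    then show ?case using step[of f _ z "-1"] by auto
  qed
qed

lemma fermat_int:
  fixes a :: int
  assumes "prime p" "\<not> int p dvd a"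
  shows "[a ^ (p - 1) = 1] (mod int p)"
proof -
  have "coprime a (int p)"
    using assms by (metis coprime_commute prime_imp_coprime prime_nat_int_transfer)
  moreover have "residues (int p)"
    using assms(1) prime_gt_1_nat by (auto simp: residues_def)
  ultimately show ?thesis
    using residues.euler_theorem[of "int p" a] assms(1) by (simp add: totient_prime)
qed

lemma unity_sum_prime_mult_cong:
  assumes f: "unity_sum m (\<lambda>n. of_int (S n))"
    and p: "prime p" "odd p" "m < p" and "m > 0"
  shows "int p dvd S (p * n) - S n"
proof -
  \<comment> \<open>\<open>D = p h\<close> is integer-valued, but \<open>h\<close> need not be a priori.  Since \<open>h\<^sup>p\<^sup>-\<^sup>1\<close> sums to an integer
    over a period, \<open>p\<close> divides \<open>(\<Sum>n<m. D(n)\<^sup>p\<^sup>-\<^sup>1)\<close>, which by Fermat counts the \<open>n < m\<close> with \<open>p\<close>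
    not dividing \<open>D(n)\<close>; there are at most \<open>m < p\<close> of these, hence none.\<close>
  obtain h where h: "unity_sum m h" "\<And>n. of_int (S (p * n)) = of_int (S n) ^ p + of_nat p * h n"
    using unity_sum_frobenius[OF f p(1,2)] by blast
  define D where "D n = S (p * n) - S n ^ p" for n
  have D: "of_int (D n) = of_nat p * h n" for n
    by (simp add: D_def h(2))
  obtain c :: int where "(\<Sum>n<m. h n ^ (p - 1)) = of_nat m * of_int c"
    using unity_sum_sum_period[OF unity_sum_pow[OF h(1)]] by blast
  then have "(\<Sum>n<m. of_int (D n) ^ (p - 1)) = (of_int (int p ^ (p - 1) * (int m * c)) :: complex)"
    by (simp add: D power_mult_distrib flip: sum_distrib_left)
  then have "(\<Sum>n<m. D n ^ (p - 1)) = int p ^ (p - 1) * (int m * c)"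
    by (metis (no_types, lifting) of_int_eq_iff of_int_power of_int_sum sum.cong)
  then have dvd: "int p dvd (\<Sum>n<m. D n ^ (p - 1))"
    using prime_gt_1_nat[OF p(1)] by (simp add: dvd_mult2 dvd_power)
  have "[(\<Sum>n<m. D n ^ (p - 1)) = (\<Sum>n<m. if int p dvd D n then 0 else 1)] (mod int p)"
    using fermat_int[OF p(1)] prime_gt_1_nat[OF p(1)]
    by (intro cong_sum) (auto simp: cong_0_iff dvd_power dvd_trans[OF _ dvd_power])
  also have "(\<Sum>n<m. if int p dvd D n then 0 else 1) = int (card {n. n < m \<and> \<not> int p dvd D n})"
    by (simp add: sum.If_cases Int_def lessThan_def)
  finally have "int p dvd int (card {n. n < m \<and> \<not> int p dvd D n})"
    using dvd by (simp add: cong_dvd_iff)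
  moreover have "card {n. n < m \<and> \<not> int p dvd D n} \<le> card {..<m}"
    by (intro card_mono) auto
  ultimately have "card {n. n < m \<and> \<not> int p dvd D n} = 0"
    using p(3) by (metis card_lessThan dvd_imp_le int_dvd_int_iff leD le_less_trans neq0_conv)
  then have "int p dvd D n" if "n < m" for n
    using that by auto
  \<comment> \<open>Periodicity carries the divisibility from one period to every
    \<open>n\<close>.\<close>
  moreover have "D (n mod m) = D n"
  proof -
    have "unity_sum m (\<lambda>n. of_int (D n))"
      unfolding D using h(1) by (intro unity_sum_mult unity_sum_of_nat)
    from unity_sum_cong[OF this, of "n mod m" n] show ?thesis by (simp add: cong_def)
  qed
  ultimately have "int p dvd D n"
    using \<open>m > 0\<close> by (metis mod_less_divisor)
  moreover have "int p dvd S n ^ p - S n"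
  proof (cases "int p dvd S n")
    case True
    then show ?thesis using prime_gt_0_nat[OF p(1)] by (intro dvd_diff) (auto intro: dvd_trans dvd_power)
  next
    case False
    have "S n ^ p - S n = S n * (S n ^ (p - 1) - 1)"
      using prime_gt_0_nat[OF p(1)] by (cases p) (auto simp: algebra_simps)
    then show ?thesis using fermat_int[OF p(1) False] by (simp add: cong_iff_dvd_diff)
  qed
  ultimately have "int p dvd D n + (S n ^ p - S n)" by (rule dvd_add)
  then show ?thesis by (simp add: D_def)
qed

section \<open>From prime multipliers to the gcd with the modulus\<close>

text \<open>Take \<open>k = a + b * Q\<close> with \<open>Q\<close> the product of the primes up to
  \<open>B\<close> that do not divide \<open>a\<close>. Every prime up to \<open>B\<close> then
  divides exactly one of the two summands, so it does not divide \<open>k\<close>.\<close>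

lemma ex_cong_large_prime_factors:
  fixes a b :: nat
  assumes "coprime a b" "b > 0"
  shows "\<exists>k. [k = a] (mod b) \<and> k > 0 \<and> (\<forall>p. prime p \<longrightarrow> p dvd k \<longrightarrow> B < p)"
proof -
  define Q where "Q = (\<Prod>{q. prime q \<and> q \<le> B \<and> \<not> q dvd a})"
  have fin: "finite {q. prime q \<and> q \<le> B \<and> \<not> q dvd a}" 
    by (rule finite_subset[of _ "{..B}"]) auto
  have "Q > 0" using fin by (auto simp: Q_def prime_gt_0_nat intro!: prod_pos)
  have "\<not> p dvd a + b * Q" if p: "prime p" "p \<le> B" for p
  proof (cases "p dvd a")
    case True
    have "\<not> p dvd b" using True assms(1) p(1) by (metis coprime_common_divisor_nat not_prime_1)
    moreover have "\<not> p dvd Q"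
    proof
      assume "p dvd Q"
      then obtain q where "prime q" "\<not> q dvd a" "p dvd q"
        using fin p(1) by (auto simp: Q_def prime_dvd_prod_iff)
      then show False using True p(1) primes_dvd_imp_eq by blast
    qed
    ultimately show ?thesis using True p(1) by (simp add: dvd_add_right_iff prime_dvd_mult_iff)
  next
    case False
    then have "p dvd Q" using p fin by (auto simp: Q_def intro: dvd_prodI)
    then show ?thesis using False by (simp add: dvd_add_left_iff)
  qed
  moreover have "a + b * Q > 0" using \<open>Q > 0\<close> assms(2) by simp
  moreover have "[a + b * Q = a] (mod b)" by (simp add: cong_def)
  ultimately show ?thesis by (metis not_le_imp_less)
qed

lemma unity_sum_int_gcd:
  assumes f: "unity_sum m (\<lambda>n. of_int (S n))" and m: "m > 0"
  shows "S n = S (gcd n m)"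
proof -
  obtain C where C: "\<And>n. norm (of_int (S n) :: complex) \<le> C"
    using unity_sum_bounded[OF f m] by blast
  \<comment> \<open>For \<open>p > B\<close>, the bound 2 makes \<open>p\<close> odd, the bound
    \<open>m\<close> allows the congruence, and \<open>2 * C\<close> forces a difference divisible
    by \<open>p\<close> to vanish.\<close>
  define B where "B = max 2 (max m (nat \<lceil>2 * C\<rceil>))"
  have prime_step: "S (p * n) = S n" if p: "prime p" "B < p" for p n
  proof -
    have "odd p" "m < p" using p prime_odd_nat by (auto simp: B_def)
    then have "int p dvd S (p * n) - S n" using unity_sum_prime_mult_cong[OF f p(1)] m by blast
    moreover have "\<bar>S (p * n) - S n\<bar> < int p"
    proof -
      have "real_of_int \<bar>S (p * n) - S n\<bar> \<le> 2 * C"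
        using C[of n] C[of "p * n"] by simp
      also have "2 * C < real p" using p(2) unfolding B_def by linarith
      finally show ?thesis by linarith
    qed
    ultimately show ?thesis using zdvd_not_zless[of "\<bar>S (p * n) - S n\<bar>" "int p"] by auto
  qed
  have step: "S (k * n) = S n" if "k > 0" "\<forall>p. prime p \<longrightarrow> p dvd k \<longrightarrow> B < p" for k n
    using that
  proof (induction k arbitrary: n rule: prime_divisors_induct)
    case (factor p k)
    then have "S (p * (k * n)) = S (k * n)" using prime_step by auto
    also have "\<dots> = S n" using factor by (auto simp: dvd_mult)
    finally show ?case by (simp add: mult.assoc)
  qed auto
  \<comment> \<open>After division by \<open>d\<close> the residue \<open>n div d\<close> is coprime
    to \<open>m div d\<close>, so it has a representative \<open>k\<close> to which
    \<open>step\<close> applies; multiplying back gives \<open>k * d\<close> congruent to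
    \<open>n\<close>.\<close>
  define d where "d = gcd n m"
  have d: "d > 0" "n = d * (n div d)" "m = d * (m div d)" using m by (auto simp: d_def)
  have "coprime (n div d) (m div d)" using m by (simp add: d_def div_gcd_coprime)
  moreover have "m div d > 0" using m d by (metis gr0I mult_0_right)
  ultimately obtain k where k: "[k = n div d] (mod (m div d))" "k > 0" 
      "\<forall>p. prime p \<longrightarrow> p dvd k \<longrightarrow> B < p"
    using ex_cong_large_prime_factors by blast
  have "[d * k = d * (n div d)] (mod (d * (m div d)))"
    using k(1) d(1) by (intro cong_cmult_leftI)
  then have "[k * d = n] (mod m)" using d by (simp add: mult.commute)
  from unity_sum_cong[OF f this] have "S n = S (k * d)" by simp
  also have "\<dots> = S d" using step k by blast
  finally show ?thesis by (simp add: d_def)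
qed

section \<open>Inversion of divisor sums\<close>

function divisor_inverse :: "(nat \<Rightarrow> 'b::field_char_0) \<Rightarrow> nat \<Rightarrow> 'b" where
  "divisor_inverse s n = (if n = 0 then 0 else
     (s n - (\<Sum>d\<in>{d. d dvd n \<and> d < n}. of_nat d * divisor_inverse s d)) / of_nat n)"
  by auto
termination by (relation "measure snd") auto

declare divisor_inverse.simps [simp del]

lemma divisor_inverse_0 [simp]: "divisor_inverse s 0 = 0"
  by (subst divisor_inverse.simps) simp

lemma divisors_insert: "n > 0 \<Longrightarrow> {d. d dvd n} = insert n {d. d dvd n \<and> d < (n::nat)}"
  by (auto dest: dvd_imp_le)

lemma divisor_inverse_sum:
  assumes "n \<ge> 1"
  shows "(\<Sum>d | d dvd n. of_nat d * divisor_inverse s d) = s n"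
proof -
  have "of_nat n * divisor_inverse s n = s n - (\<Sum>d\<in>{d. d dvd n \<and> d < n}. of_nat d * divisor_inverse s d)"
    using assms by (subst divisor_inverse.simps) simp
  then show ?thesis using assms by (subst divisors_insert) auto
qed

lemma divisor_sum_unique:
  fixes a b :: "nat \<Rightarrow> 'b::field_char_0"
  assumes "\<And>n. n \<ge> 1 \<Longrightarrow> (\<Sum>d | d dvd n. of_nat d * a d) = (\<Sum>d | d dvd n. of_nat d * b d)"
    and "n \<ge> 1"
  shows "a n = b n"
  using assms(2)
proof (induction n rule: less_induct)
  case (less n)
  have "a d = b d" if "d dvd n" "d < n" for d
    using that less by (intro less.IH) (auto simp: Suc_le_eq intro: gr0I)
  then have "(\<Sum>d\<in>{d. d dvd n \<and> d < n}. of_nat d * a d) = (\<Sum>d\<in>{d. d dvd n \<and> d < n}. of_nat d * b d)"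
    by (intro sum.cong) auto
  then show ?case
    using assms(1)[OF less.prems] less.prems by (simp add: divisors_insert)
qed

text \<open>The divisors of \<open>gcd k m\<close> are the divisors of \<open>k\<close> that divide
  \<open>m\<close>. Hence the truncation \<open>b\<close> has the same divisor sums as the full
  inverse, and uniqueness identifies the two.\<close>

lemma divisor_inverse_eq_0:
  fixes s :: "nat \<Rightarrow> 'b::field_char_0"
  assumes m: "m > 0" and s: "\<And>n. n \<ge> 1 \<Longrightarrow> s n = s (gcd n m)" and n: "n \<ge> 1" "\<not> n dvd m"
  shows "divisor_inverse s n = 0"
proof -
  define b where "b d = (if d dvd m then divisor_inverse s d else 0)" for d
  have "(\<Sum>d | d dvd k. of_nat d * divisor_inverse s d) = (\<Sum>d | d dvd k. of_nat d * b d)" if "k \<ge> 1" for k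
  proof -
    have "(\<Sum>d | d dvd k. of_nat d * b d) = (\<Sum>d | d dvd gcd k m. of_nat d * divisor_inverse s d)"
      using that by (intro sum.mono_neutral_cong_right) (auto simp: b_def)
    also have "\<dots> = s (gcd k m)"
      using that by (intro divisor_inverse_sum) (simp add: Suc_le_eq)
    also have "\<dots> = s k" using s[OF that] by simp
    finally show ?thesis using divisor_inverse_sum[OF that, of s] by simp
  qed
  from divisor_sum_unique[OF this n(1)] show ?thesis using n(2) by (simp add: b_def)
qed

section \<open>Integrality from finite support\<close>

lemma Ints_of_multiple_sums:
  fixes a :: "nat \<Rightarrow> complex"
  assumes "\<And>e. e \<in> {1..N} \<Longrightarrow> (\<Sum>d | d \<in> {1..N} \<and> e dvd d. a d) \<in> \<int>"
    and "e \<in> {1..N}"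
  shows "a e \<in> \<int>"
  using assms(2)
proof (induction "N - e" arbitrary: e rule: less_induct)
  case less
  have "{d. d \<in> {1..N} \<and> e dvd d} = insert e {d. d \<in> {1..N} \<and> e dvd d \<and> d > e}"
    using less.prems by (auto dest: dvd_imp_le simp: le_less)
  then have "(\<Sum>d | d \<in> {1..N} \<and> e dvd d. a d) = a e + (\<Sum>d | d \<in> {1..N} \<and> e dvd d \<and> d > e. a d)"
    by simp
  moreover have "(\<Sum>d | d \<in> {1..N} \<and> e dvd d \<and> d > e. a d) \<in> \<int>"
    using less by (intro Ints_sum less.hyps) auto
  ultimately show ?case using assms(1)[OF less.prems] by (metis Ints_diff add_diff_cancel_right')
qed

text \<open>Divisor sums need indices from 1, geometric sums start at 0; this passes between the
  two.\<close>

lemma sum_shift_periodic: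
  fixes f :: "nat \<Rightarrow> 'b::comm_ring_1"
  assumes "f m = f 0"
  shows "(\<Sum>n\<in>{1..m}. f n) = (\<Sum>n<m. f n)"
  using sum.lessThan_Suc_shift[of f m] sum.lessThan_Suc[of f m] assms
  by (simp add: sum.atLeast1_atMost_eq)

lemma ex_primitive_root_of_unity:
  assumes "e > 0"
  shows "\<exists>w::complex. \<forall>k. w ^ k = 1 \<longleftrightarrow> e dvd k"
proof -
  define w where "w = cis (2 * pi / real e)"
  have pow: "cis (2 * pi * real k / real e) = w ^ k" for k
    unfolding w_def DeMoivre by (simp add: mult.commute)
  have inj: "inj_on (\<lambda>k. w ^ k) {..<e}" and e: "w ^ e = 1"
    using bij_betw_roots_unity[OF assms] assms unfolding pow
    by (auto simp: bij_betw_def w_def DeMoivre)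
  have "w ^ k = 1 \<longleftrightarrow> e dvd k" for k
  proof -
    have "w ^ k = (w ^ e) ^ (k div e) * w ^ (k mod e)"
      unfolding power_mult[symmetric] power_add[symmetric] by (simp only: mult_div_mod_eq)
    then have "w ^ k = 1 \<longleftrightarrow> w ^ (k mod e) = w ^ 0" by (simp add: e)
    also have "\<dots> \<longleftrightarrow> k mod e = 0"
      by (rule inj_on_eq_iff[OF inj]) (use assms in auto)
    finally show ?thesis by (simp add: dvd_eq_mod_eq_0)
  qed
  then show ?thesis by blast
qed

lemma unity_sum_finite_divisor_support:
  assumes s: "unity_sum m s" "m > 0"
    and a: "\<And>n. n \<ge> 1 \<Longrightarrow> s n = (\<Sum>d | d dvd n. of_nat d * a d)"
    and N: "\<And>d. d > N \<Longrightarrow> a d = 0"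
    and e: "e \<ge> 1"
  shows "a e \<in> \<int>"
proof (cases "e \<le> N")
  case True
  \<comment> \<open>A multiple of \<open>m\<close>, so that \<open>s\<close> has period
    \<open>M\<close>, and of every \<open>d\<close> up to \<open>N\<close>, so that each inner
    geometric sum runs over whole periods.\<close>
  define M where "M = m * fact N"
  have M: "M > 0" using s(2) by (simp add: M_def)
  have dvdM: "d dvd M" if "d \<in> {1..N}" for d
    using that unfolding M_def by (intro dvd_mult dvd_fact) auto
  have sM: "unity_sum M s" using s(1) by (rule unity_sum_dvd) (simp add: M_def)
  show ?thesis
  proof (rule Ints_of_multiple_sums[of N a])
    fix e assume e: "e \<in> {1..N}"
    then obtain w :: complex where w1: "w ^ k = 1 \<longleftrightarrow> e dvd k" for k
      using ex_primitive_root_of_unity[of e] by auto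
    have wM: "w ^ M = 1" using dvdM[OF e] by (simp add: w1)
    have per: "unity_sum M (\<lambda>n. s n * w ^ n)" using sM wM by (rule unity_sum_mult_power)
    have "(\<Sum>n\<in>{1..M}. s n * w ^ n) = (\<Sum>n<M. s n * w ^ n)"
      using unity_sum_periodic[OF per, of 0 1] by (intro sum_shift_periodic) simp
    then obtain c :: int where c: "(\<Sum>n\<in>{1..M}. s n * w ^ n) = of_nat M * of_int c"
      using unity_sum_sum_period[OF per] by auto
    have "(\<Sum>n\<in>{1..M}. s n * w ^ n) = (\<Sum>n\<in>{1..M}. \<Sum>d\<in>{1..N}. if d dvd n then of_nat d * a d * w ^ n else 0)"
    proof (rule sum.cong[OF refl])
      fix n assume n: "n \<in> {1..M}"
      have "s n * w ^ n = (\<Sum>d | d dvd n. of_nat d * a d * w ^ n)"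
        using n by (simp add: a sum_distrib_right)
      also have "\<dots> = (\<Sum>d | d \<in> {1..N} \<and> d dvd n. of_nat d * a d * w ^ n)"
      proof (rule sum.mono_neutral_right)
        show "\<forall>i\<in>{d. d dvd n} - {d \<in> {1..N}. d dvd n}. of_nat i * a i * w ^ n = 0"
          using N n by (auto simp: Suc_le_eq intro: dvd_pos_nat) (metis not_le)
      qed (use n in auto)
      also have "\<dots> = (\<Sum>d\<in>{1..N}. if d dvd n then of_nat d * a d * w ^ n else 0)"
        by (intro sum.mono_neutral_cong_left) auto
      finally show "s n * w ^ n = (\<Sum>d\<in>{1..N}. if d dvd n then of_nat d * a d * w ^ n else 0)" .
    qed
    also have "\<dots> = (\<Sum>d\<in>{1..N}. \<Sum>n\<in>{1..M}. if d dvd n then of_nat d * a d * w ^ n else 0)"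
      by (rule sum.swap)
    also have "\<dots> = (\<Sum>d\<in>{1..N}. if e dvd d then of_nat M * a d else 0)"
    proof (rule sum.cong[OF refl])
      fix d assume d: "d \<in> {1..N}"
      then obtain q where q: "M = d * q" using dvdM by blast
      have "(\<Sum>n\<in>{1..M}. if d dvd n then of_nat d * a d * w ^ n else 0) =
          (\<Sum>n | n \<in> {1..M} \<and> d dvd n. of_nat d * a d * w ^ n)"
        by (intro sum.mono_neutral_cong_right) auto
      \<comment> \<open>Writing \<open>n = d * j\<close> leaves a geometric sum in
        \<open>w ^ d\<close>, which is \<open>q\<close> if \<open>e\<close> divides \<open>d\<close>
        and 0 otherwise; the factor \<open>d\<close> completes \<open>q\<close> to
        \<open>M\<close>.\<close>
      also have "\<dots> = (\<Sum>j\<in>{1..q}. of_nat d * a d * (w ^ d) ^ j)"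
        using d by (intro sum.reindex_bij_witness[of _ "\<lambda>j. d * j" "\<lambda>n. n div d"])
          (auto simp: q power_mult Suc_le_eq)
      also have "\<dots> = of_nat d * a d * (\<Sum>j\<in>{1..q}. (w ^ d) ^ j)"
        by (simp only: sum_distrib_left)
      also have "(\<Sum>j\<in>{1..q}. (w ^ d) ^ j) = (if w ^ d = 1 then of_nat q else 0)"
      proof -
        have "(w ^ d) ^ q = 1" using wM by (simp add: q power_mult)
        then show ?thesis
          using sum_powers_root_of_unity[of "w ^ d" q] by (subst sum_shift_periodic) auto
      qed
      finally show "(\<Sum>n\<in>{1..M}. if d dvd n then of_nat d * a d * w ^ n else 0) =
          (if e dvd d then of_nat M * a d else 0)"
        by (simp add: w1 q)
    qed
    also have "\<dots> = of_nat M * (\<Sum>d | d \<in> {1..N} \<and> e dvd d. a d)"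
      unfolding sum_distrib_left by (intro sum.mono_neutral_cong_right) auto
    finally have "(\<Sum>d | d \<in> {1..N} \<and> e dvd d. a d) = of_int c" using c M by simp
    then show "(\<Sum>d | d \<in> {1..N} \<and> e dvd d. a d) \<in> \<int>" by simp
  qed (use e True in auto)
qed (use N in auto)

section \<open>Logarithmic derivatives of power series\<close>

no_notation vec_index (infixl "$" 100)
unbundle fps_syntax

text \<open>Evaluation of coefficients at a point. It moves series over the function ring, which has
  zero divisors, to series over the complex numbers, where factors can be cancelled.\<close>

definition fps_at :: "'a \<Rightarrow> ('a \<Rightarrow> 'b::comm_ring_1) fps \<Rightarrow> 'b fps" where
  "fps_at g F = Abs_fps (\<lambda>n. (F $ n) g)"

lemma fps_at_nth [simp]: "fps_at g F $ n = (F $ n) g"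
  by (simp add: fps_at_def)

lemma sum_fun_apply: "(sum f A) x = (\<Sum>i\<in>A. f i x)"
  by (induction A rule: infinite_finite_induct) auto

lemma fps_at_1 [simp]: "fps_at g 1 = 1"
  by (simp add: fps_eq_iff)

lemma fps_at_mult [simp]: "fps_at g (F * H) = fps_at g F * fps_at g H"
  by (simp add: fps_eq_iff fps_mult_nth sum_fun_apply)

lemma fps_at_power [simp]: "fps_at g (F ^ n) = fps_at g F ^ n"
  by (induction n) auto

lemma fps_at_prod: "fps_at g (\<Prod>i\<in>A. F i) = (\<Prod>i\<in>A. fps_at g (F i))"
  by (induction A rule: infinite_finite_induct) auto

lemma fps_at_uminus [simp]: "fps_at g (- F) = - fps_at g F"
  by (simp add: fps_eq_iff)

lemma fps_at_X [simp]: "fps_at g fps_X = fps_X"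
  by (simp add: fps_eq_iff fps_X_def)

lemma fps_at_compose: "fps_at g (fps_compose F H) = fps_compose (fps_at g F) (fps_at g H)"
  by (simp add: fps_eq_iff fps_compose_nth sum_fun_apply flip: fps_at_power)

text \<open>Basic neighbourhoods in the \<open>t\<close>-adic topology fix finitely many
  coefficients. Initial segments are used to match \<open>has_logderiv_eq_iff\<close>.\<close>

lemma tendsto_fps_iff_nth:
  fixes F :: "'i \<Rightarrow> 'b::comm_ring_1 fps"
  shows "(F \<longlongrightarrow> L) net \<longleftrightarrow> (\<forall>k. \<forall>\<^sub>F n in net. \<forall>j\<le>k. F n $ j = L $ j)"
proof
  assume lim: "(F \<longlongrightarrow> L) net"
  show "\<forall>k. \<forall>\<^sub>F n in net. \<forall>j\<le>k. F n $ j = L $ j"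
  proof
    fix k
    have "open {H. \<forall>j\<le>k. H $ j = L $ j}"
      unfolding open_fps_iff
    proof (intro ballI exI[of _ "Suc k"])
      fix H assume H: "H \<in> {H. \<forall>j\<le>k. H $ j = L $ j}"
      show "{G. fps_cutoff (Suc k) G = fps_cutoff (Suc k) H} \<subseteq> {H. \<forall>j\<le>k. H $ j = L $ j}"
      proof (intro subsetI CollectI allI impI)
        fix G j assume "G \<in> {G. fps_cutoff (Suc k) G = fps_cutoff (Suc k) H}" and j: "j \<le> k"
        then have "fps_cutoff (Suc k) G $ j = fps_cutoff (Suc k) H $ j" by simp
        then show "G $ j = L $ j" using H j by simp
      qed
    qed
    from topological_tendstoD[OF lim this] show "\<forall>\<^sub>F n in net. \<forall>j\<le>k. F n $ j = L $ j" by simp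
  qed
next
  assume *: "\<forall>k. \<forall>\<^sub>F n in net. \<forall>j\<le>k. F n $ j = L $ j"
  show "(F \<longlongrightarrow> L) net"
  proof (rule topological_tendstoI)
    fix S assume "open S" "L \<in> S"
    then obtain k where k: "{G. fps_cutoff k G = fps_cutoff k L} \<subseteq> S"
      by (auto simp: open_fps_iff)
    have "\<forall>\<^sub>F n in net. \<forall>j\<le>k. F n $ j = L $ j" using * by blast
    then show "\<forall>\<^sub>F n in net. F n \<in> S"
      by eventually_elim (use k in \<open>auto simp: fps_eq_iff\<close>)
  qed
qed

text \<open>\<open>l\<close> is \<open>t f'/f\<close>, stated without division. The factor
  \<open>t\<close> places the contribution of the \<open>n\<close>-th Adams operation at degree
  \<open>n\<close>.\<close>

definition has_logderiv :: "'b::field_char_0 fps \<Rightarrow> 'b fps \<Rightarrow> bool" where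
  "has_logderiv f l \<longleftrightarrow> f $ 0 = 1 \<and> fps_X * fps_deriv f = f * l"

lemma has_logderiv_1: "has_logderiv 1 0"
  by (simp add: has_logderiv_def)

lemma has_logderiv_mult:
  "has_logderiv f l \<Longrightarrow> has_logderiv g k \<Longrightarrow> has_logderiv (f * g) (l + k)"
  unfolding has_logderiv_def
  by (simp add: distrib_left mult.left_commute[of fps_X]) (simp add: mult.left_commute mult.commute)

lemma has_logderiv_prod:
  "(\<And>i. i \<in> A \<Longrightarrow> has_logderiv (f i) (l i)) \<Longrightarrow> has_logderiv (\<Prod>i\<in>A. f i) (\<Sum>i\<in>A. l i)"
  by (induction A rule: infinite_finite_induct) (auto intro: has_logderiv_1 has_logderiv_mult)

lemma has_logderiv_nth:
  assumes "has_logderiv f l"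
  shows "of_nat n * f $ n = l $ n + (\<Sum>i\<in>{1..n}. f $ i * l $ (n - i))"
proof -
  have "of_nat n * f $ n = (fps_X * fps_deriv f) $ n" by (cases n) auto
  also have "\<dots> = (\<Sum>i=0..n. f $ i * l $ (n - i))"
    using assms by (simp add: has_logderiv_def fps_mult_nth)
  also have "\<dots> = l $ n + (\<Sum>i\<in>{1..n}. f $ i * l $ (n - i))"
    using assms by (simp add: has_logderiv_def sum.atLeast_Suc_atMost)
  finally show ?thesis .
qed

lemma has_logderiv_nth_0:
  assumes "has_logderiv f l"
  shows "l $ 0 = 0"
  using has_logderiv_nth[OF assms, of 0] by simp

text \<open>The recursion \<open>has_logderiv_nth\<close> is triangular in both directions, and in
  characteristic 0 the factor \<open>n\<close> can be cancelled, so even truncations determine each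
  other.\<close>

lemma has_logderiv_eq_iff:
  assumes f: "has_logderiv f l" and g: "has_logderiv g k"
  shows "(\<forall>j\<le>n. f $ j = g $ j) \<longleftrightarrow> (\<forall>j\<le>n. l $ j = k $ j)"
proof safe
  fix j assume "\<forall>j\<le>n. f $ j = g $ j" "j \<le> n"
  then show "l $ j = k $ j"
  proof (induction j rule: less_induct)
    case (less j)
    then have "(\<Sum>i\<in>{1..j}. f $ i * l $ (j - i)) = (\<Sum>i\<in>{1..j}. g $ i * k $ (j - i))"
      by (intro sum.cong) auto
    then show ?case
      using has_logderiv_nth[OF f, of j] has_logderiv_nth[OF g, of j] less.prems by simp
  qed
next
  fix j assume *: "\<forall>j\<le>n. l $ j = k $ j" "j \<le> n"
  then show "f $ j = g $ j"
  proof (induction j rule: less_induct)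
    case (less j)
    show ?case
    proof (cases "j = 0")
      case True
      then show ?thesis using f g by (simp add: has_logderiv_def)
    next
      case False
      \<comment> \<open>At \<open>i = j\<close> the unknown \<open>f $ j\<close> is multiplied by
        \<open>l $ 0 = 0\<close>, so only earlier coefficients matter.\<close>
      have "f $ i * l $ (j - i) = g $ i * k $ (j - i)" if "i \<le> j" for i
        using less that has_logderiv_nth_0[OF f] has_logderiv_nth_0[OF g] by (cases "i = j") auto
      then have "of_nat j * f $ j = of_nat j * g $ j"
        unfolding has_logderiv_nth[OF f] has_logderiv_nth[OF g] using less.prems
        by (intro arg_cong2[where f = "(+)"] sum.cong) auto
      then show ?thesis using False by simp
    qed
  qed
qed

lemma has_logderiv_exp:
  assumes "F $ 0 = 0"
  shows "has_logderiv (fps_exp 1 oo F) (fps_X * fps_deriv F)"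
  using assms by (simp add: has_logderiv_def fps_compose_deriv mult_ac)

text \<open>\<open>B = (1 - u)^a\<close> solves \<open>(1 - u) B' = - a B\<close>, and
  \<open>u = (-t)^i\<close> satisfies \<open>t u' = i u\<close>. The logarithmic derivative is
  therefore \<open>- a i u / (1 - u)\<close>, a geometric series supported on multiples of
  \<open>i\<close>.\<close>

lemma has_logderiv_binomial:
  fixes a :: "'b::field_char_0"
  assumes i: "i \<ge> 1"
  shows "has_logderiv (Abs_fps (\<lambda>k. (-1) ^ k * (a gchoose k)) oo (- fps_X) ^ i)
    (Abs_fps (\<lambda>n. if n > 0 \<and> i dvd n then - ((-1) ^ n) * of_nat i * a else 0))"
    (is "has_logderiv (?B oo ?U) ?l")
proof -
  have U: "?U = fps_const ((-1) ^ i) * fps_X ^ i"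
    by (subst power_minus) (simp flip: fps_const_power fps_const_neg)
  have U0: "?U $ 0 = 0" using i by (simp add: U)
  have "((1 - fps_X) * fps_deriv ?B) $ n = (- (fps_const a * ?B)) $ n" for n
  proof (cases n)
    case 0
    then show ?thesis by (simp add: left_diff_distrib)
  next
    case (Suc k)
    have "(a gchoose n) * a = of_nat n * (a gchoose n) + of_nat (Suc n) * (a gchoose Suc n)"
      by (rule gbinomial_mult_1')
    then have "(-1) ^ n * ((a gchoose n) * a) =
        (-1) ^ n * (of_nat n * (a gchoose n) + of_nat (Suc n) * (a gchoose Suc n))" by simp
    then show ?thesis using Suc by (simp add: left_diff_distrib algebra_simps)
  qed
  then have "(1 - fps_X) * fps_deriv ?B = - (fps_const a * ?B)" by (simp add: fps_eq_iff)
  then have "((1 - fps_X) * fps_deriv ?B) oo ?U = (- (fps_const a * ?B)) oo ?U" by simp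
  then have B: "(1 - ?U) * (fps_deriv ?B oo ?U) = - (fps_const a * (?B oo ?U))"
    by (simp only: fps_compose_mult_distrib[OF U0] fps_compose_sub_distrib fps_compose_uminus
        fps_X_fps_compose_startby0[OF U0] fps_const_compose fps_compose_1)
  have XU: "fps_X * fps_deriv ?U = of_nat i * ?U"
  proof (rule fps_ext)
    fix n
    have "?U $ k = (if k = i then (-1) ^ i else 0)" for k by (simp add: U fps_X_power_iff)
    then show "(fps_X * fps_deriv ?U) $ n = (of_nat i * ?U) $ n"
      by (cases n) (auto simp: fps_of_nat[symmetric])
  qed
  \<comment> \<open>Multiplication by \<open>1 - u\<close> telescopes the geometric series; this
    factor is kept on both sides and cancelled at the end.\<close>
  have l: "?l * (1 - ?U) = - (fps_const a * of_nat i * ?U)"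
  proof (rule fps_ext)
    fix n
    have "(?l * ?U) $ n = (fps_const ((-1) ^ i) * (fps_X ^ i * ?l)) $ n"
      by (simp only: U mult_ac)
    also have "\<dots> = (-1) ^ i * (if n < i then 0 else ?l $ (n - i))"
      by (simp only: fps_mult_left_const_nth fps_X_power_mult_nth)
    finally have "(?l * (1 - ?U)) $ n = ?l $ n - (-1) ^ i * (if n < i then 0 else ?l $ (n - i))"
      by (simp add: right_diff_distrib)
    also have "\<dots> = (if n = i then - ((-1) ^ i * of_nat i * a) else 0)"
    proof (cases n i rule: linorder_cases)
      case less
      then show ?thesis by (auto dest: dvd_imp_le)
    next
      case equal
      then show ?thesis using i by simp
    next
      case greater
      then have "i dvd n \<longleftrightarrow> i dvd n - i" by (metis dvd_minus_self less_imp_le_nat not_less)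
      moreover have "(-1) ^ n = (-1) ^ i * (-1 :: 'b) ^ (n - i)" using greater by (simp flip: power_add)
      ultimately show ?thesis using greater by simp
    qed
    also have "\<dots> = (- (fps_const a * of_nat i * ?U)) $ n"
      by (simp add: U mult.assoc fps_of_nat[symmetric] fps_X_power_iff)
    finally show "(?l * (1 - ?U)) $ n = (- (fps_const a * of_nat i * ?U)) $ n" .
  qed
  have "(1 - ?U) * (fps_X * fps_deriv (?B oo ?U)) = (fps_X * fps_deriv ?U) * ((1 - ?U) * (fps_deriv ?B oo ?U))"
    by (simp only: fps_compose_deriv[OF U0] mult_ac)
  also have "\<dots> = (?B oo ?U) * - (fps_const a * of_nat i * ?U)"
    by (simp only: B XU) (simp add: mult_ac)
  also have "\<dots> = (?B oo ?U) * (?l * (1 - ?U))"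
    by (simp only: l)
  also have "\<dots> = (1 - ?U) * ((?B oo ?U) * ?l)"
    by (simp only: mult_ac)
  finally have "(1 - ?U) * (fps_X * fps_deriv (?B oo ?U)) = (1 - ?U) * ((?B oo ?U) * ?l)" .
  moreover have "(1 - ?U) $ 0 = 1" using U0 by simp
  then have "1 - ?U \<noteq> 0" by (metis fps_zero_nth zero_neq_one)
  ultimately have "fps_X * fps_deriv (?B oo ?U) = (?B oo ?U) * ?l" by simp
  then show ?thesis by (simp add: has_logderiv_def)
qed

text \<open>For \<open>exp F\<close> the logarithmic derivative is \<open>t F'\<close>, and
  differentiation cancels the denominators \<open>i\<close>.\<close>

lemma has_logderiv_lambda_t:
  "has_logderiv (fps_at g (lambda_t G f)) (Abs_fps (\<lambda>n. if n = 0 then 0 else - ((-1) ^ n) * adams G n f g))"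
proof -
  define F where "F = Abs_fps (\<lambda>i. if i = 0 then 0 else - (adams G i f g / of_nat i * (-1) ^ i))"
  have "Abs_fps (\<lambda>k. 1 / fact k) = fps_exp (1::complex)"
    by (simp add: fps_eq_iff)
  then have "fps_at g (lambda_t G f) = fps_exp 1 oo F"
    unfolding lambda_t_def exp_series_def fps_at_compose
    by (intro arg_cong2[where f = fps_compose]) (auto simp: fps_eq_iff F_def)
  moreover have "fps_X * fps_deriv F = Abs_fps (\<lambda>n. if n = 0 then 0 else - ((-1) ^ n) * adams G n f g)"
    by (simp add: fps_eq_iff F_def)
  ultimately show ?thesis
    using has_logderiv_exp[of F] by (simp add: F_def)
qed

lemma necklace_product_tendsto_iff:
  "(\<lambda>n. \<Prod>i=1..n. one_minus_powr ((- fps_X) ^ i) (a i)) \<longlonglongrightarrow> lambda_t G f \<longleftrightarrow>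
   (\<forall>g. \<forall>n\<ge>1. (\<Sum>d | d dvd n. of_nat d * a d g) = adams G n f g)"
  (is "?P \<longlonglongrightarrow> ?L \<longleftrightarrow> _")
proof -
  define l where "l N g = (\<Sum>i\<in>{1..N}. Abs_fps (\<lambda>n. if n > 0 \<and> i dvd n then - ((-1) ^ n) * of_nat i * a i g else 0))"
    for N g
  define k where "k g = Abs_fps (\<lambda>n. if n = 0 then 0 else - ((-1) ^ n) * adams G n f g)" for g
  have P: "has_logderiv (fps_at g (?P N)) (l N g)" for N g
    unfolding fps_at_prod l_def one_minus_powr_def fps_at_compose
    using has_logderiv_binomial[of _ "a _ g"]
    by (intro has_logderiv_prod) (auto simp: fps_at_def[of g "Abs_fps _"])
  have L: "has_logderiv (fps_at g ?L) (k g)" for g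
    unfolding k_def by (rule has_logderiv_lambda_t)
  \<comment> \<open>Only factors whose index divides \<open>n\<close> contribute at degree
    \<open>n\<close>, so the partial product up to \<open>N >= n\<close> already shows the full
    divisor sum.\<close>
  have l_nth: "l N g $ n = - ((-1) ^ n) * (\<Sum>d | d dvd n. of_nat d * a d g)" if "1 \<le> n" "n \<le> N" for N n g
  proof -
    have "l N g $ n = (\<Sum>i\<in>{1..N}. if i dvd n then - ((-1) ^ n) * (of_nat i * a i g) else 0)"
      using that by (auto simp: l_def fps_sum_nth mult.assoc intro: sum.cong)
    also have "\<dots> = (\<Sum>d | d dvd n. - ((-1) ^ n) * (of_nat d * a d g))"
    proof (rule sum.mono_neutral_cong_right)
      show "{d. d dvd n} \<subseteq> {1..N}"
      proof
        fix d assume "d \<in> {d. d dvd n}"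
        then have "d \<noteq> 0" "d \<le> n" using that by (auto intro: dvd_imp_le)
        then show "d \<in> {1..N}" using that by simp
      qed
    qed auto
    finally show ?thesis by (simp only: sum_distrib_left)
  qed
  have eq_iff: "(\<forall>j\<le>n. ?P N $ j = ?L $ j) \<longleftrightarrow>
      (\<forall>g. \<forall>j\<in>{1..n}. (\<Sum>d | d dvd j. of_nat d * a d g) = adams G j f g)" if "n \<le> N" for n N
  proof -
    have "(\<forall>j\<le>n. ?P N $ j = ?L $ j) \<longleftrightarrow> (\<forall>g. \<forall>j\<le>n. fps_at g (?P N) $ j = fps_at g ?L $ j)"
      by (simp add: fun_eq_iff) blast
    also have "\<dots> \<longleftrightarrow> (\<forall>g. \<forall>j\<le>n. l N g $ j = k g $ j)"
      by (simp only: has_logderiv_eq_iff[OF P L])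
    also have "\<dots> \<longleftrightarrow> (\<forall>g. \<forall>j\<in>{1..n}. l N g $ j = k g $ j)"
    proof -
      have "(\<forall>j\<le>n. l N g $ j = k g $ j) \<longleftrightarrow> (\<forall>j\<in>{1..n}. l N g $ j = k g $ j)" for g
      proof -
        have "{..n} = insert 0 {1..n}" by auto
        moreover have "l N g $ 0 = k g $ 0"
          by (simp only: has_logderiv_nth_0[OF P] has_logderiv_nth_0[OF L])
        ultimately show ?thesis by (metis atMost_iff insert_iff)
      qed
      then show ?thesis by simp
    qed
    also have "\<dots> \<longleftrightarrow> (\<forall>g. \<forall>j\<in>{1..n}. (\<Sum>d | d dvd j. of_nat d * a d g) = adams G j f g)"
      using that by (intro all_cong1 ball_cong) (auto simp: l_nth k_def)
    finally show ?thesis .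
  qed
  show ?thesis
    unfolding tendsto_fps_iff_nth
  proof safe
    fix g and n :: nat
    assume lim: "\<forall>k. \<forall>\<^sub>F N in sequentially. \<forall>j\<le>k. ?P N $ j = ?L $ j" and n: "1 \<le> n"
    have "\<forall>\<^sub>F N in sequentially. (\<forall>j\<le>n. ?P N $ j = ?L $ j) \<and> n \<le> N"
      by (intro eventually_conj eventually_ge_at_top lim[rule_format])
    then obtain N where "\<forall>j\<le>n. ?P N $ j = ?L $ j" "n \<le> N"
      using eventually_happens'[OF sequentially_bot] by blast
    then show "(\<Sum>d | d dvd n. of_nat d * a d g) = adams G n f g"
      unfolding eq_iff[OF \<open>n \<le> N\<close>] using n by simp
  next
    fix k assume *: "\<forall>g. \<forall>n\<ge>1. (\<Sum>d | d dvd n. of_nat d * a d g) = adams G n f g"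
    show "\<forall>\<^sub>F N in sequentially. \<forall>j\<le>k. ?P N $ j = ?L $ j"
      using eventually_ge_at_top[of k]
    proof eventually_elim
      case (elim N)
      show ?case unfolding eq_iff[OF elim] using * by simp
    qed
  qed
qed

section \<open>Characters on cyclic subgroups\<close>

lemma mat_trace_mult_commute:
  assumes "A \<in> carrier_mat n m" "B \<in> carrier_mat m n"
  shows "mat_trace (A * B) = mat_trace (B * A)"
proof -
  have "mat_trace (A * B) = (\<Sum>i<n. \<Sum>j<m. A $$ (i, j) * B $$ (j, i))"
    using assms by (auto simp: mat_trace_def scalar_prod_def atLeast0LessThan intro!: sum.cong)
  also have "\<dots> = (\<Sum>j<m. \<Sum>i<n. B $$ (j, i) * A $$ (i, j))"
    by (subst sum.swap) (simp add: mult.commute)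
  also have "\<dots> = mat_trace (B * A)"
    using assms by (auto simp: mat_trace_def scalar_prod_def atLeast0LessThan intro!: sum.cong)
  finally show ?thesis .
qed

lemma mat_trace_conjugate:
  assumes "P \<in> carrier_mat n n" "Q \<in> carrier_mat n n" "B \<in> carrier_mat n n" "Q * P = 1\<^sub>m n"
  shows "mat_trace (P * B * Q) = mat_trace B"
proof -
  have "mat_trace (P * B * Q) = mat_trace (Q * (P * B))"
    using assms by (intro mat_trace_mult_commute) auto
  also have "Q * (P * B) = B"
    using assms by (simp flip: assoc_mult_mat)
  finally show ?thesis .
qed

lemma upper_triangular_pow:
  fixes B :: "'b::comm_ring_1 mat"
  assumes B: "B \<in> carrier_mat n n" "upper_triangular B"
  shows "upper_triangular (B ^\<^sub>m k) \<and> (\<forall>i<n. (B ^\<^sub>m k) $$ (i, i) = (B $$ (i, i)) ^ k)"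
proof (induction k)
  case 0
  then show ?case using B by (auto simp: upper_triangular_def)
next
  case (Suc k)
  let ?C = "B ^\<^sub>m k"
  have C: "?C \<in> carrier_mat n n" using B by simp
  have entry: "(?C * B) $$ (i, j) = (\<Sum>l<n. ?C $$ (i, l) * B $$ (l, j))" if "i < n" "j < n" for i j
    using B(1) C that by (auto simp: scalar_prod_def atLeast0LessThan intro!: sum.cong)
  have zeroC: "?C $$ (i, l) = 0" if "l < i" "i < n" for i l
    using Suc that C by (auto simp: upper_triangular_def)
  have zeroB: "B $$ (i, l) = 0" if "l < i" "i < n" for i l
    using B that by (auto simp: upper_triangular_def)
  have "upper_triangular (?C * B)"
    unfolding upper_triangular_def
  proof (intro allI impI)
    fix i j assume "i < dim_row (?C * B)" "j < i"
    then have ij: "j < i" "i < n" using C by auto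
    have "(?C * B) $$ (i, j) = (\<Sum>l<n. ?C $$ (i, l) * B $$ (l, j))"
      using ij by (intro entry) auto
    also have "\<dots> = 0"
    proof (intro sum.neutral ballI)
      fix l assume "l \<in> {..<n}"
      then show "?C $$ (i, l) * B $$ (l, j) = 0"
        using ij zeroC[of l i] zeroB[of j l] by (cases "l < i") auto
    qed
    finally show "(?C * B) $$ (i, j) = 0" .
  qed
  moreover have "(?C * B) $$ (i, i) = B $$ (i, i) ^ Suc k" if "i < n" for i
  proof -
    have "(?C * B) $$ (i, i) = (\<Sum>l<n. if l = i then ?C $$ (i, i) * B $$ (i, i) else 0)"
      unfolding entry[OF that that]
    proof (rule sum.cong[OF refl])
      fix l assume "l \<in> {..<n}"
      then show "?C $$ (i, l) * B $$ (l, i) = (if l = i then ?C $$ (i, i) * B $$ (i, i) else 0)"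
        using that zeroC[of l i] zeroB[of i l] by (cases l i rule: linorder_cases) auto
    qed
    then show ?thesis using Suc that by simp
  qed
  ultimately show ?case by simp
qed

text \<open>In Schur form the diagonal of a power consists of the powers of the diagonal entries,
  and \<open>A ^\<^sub>m m = 1\<^sub>m n\<close> makes these entries \<open>m\<close>-th roots of
  unity.\<close>

lemma unity_sum_trace_pow:
  assumes A: "A \<in> carrier_mat n n" and "A ^\<^sub>m m = 1\<^sub>m n"
  shows "unity_sum m (\<lambda>k. mat_trace (A ^\<^sub>m k))"
proof -
  obtain es where "char_poly A = (\<Prod>e\<leftarrow>es. [:- e, 1:])"
    using char_poly_factorized[OF A] by blast
  from schur_upper_triangular[OF A this] obtain B
    where B: "B \<in> carrier_mat n n" "upper_triangular B" "similar_mat A B"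
    by blast
  obtain P Q where wit: "similar_mat_wit A B P Q"
    using B(3) unfolding similar_mat_def by blast
  note PQ = similar_mat_witD2[OF A wit]
  have pow: "A ^\<^sub>m k = P * B ^\<^sub>m k * Q" for k
    using similar_mat_wit_pow_id[OF wit] .
  have "mat_trace (A ^\<^sub>m k) = mat_trace (B ^\<^sub>m k)" for k
    unfolding pow using PQ by (intro mat_trace_conjugate) auto
  also have "mat_trace (B ^\<^sub>m k) = (\<Sum>i<n. B $$ (i, i) ^ k)" for k
    using upper_triangular_pow[OF B(1,2), of k] B(1) by (simp add: mat_trace_def)
  finally have trace: "mat_trace (A ^\<^sub>m k) = (\<Sum>i<n. B $$ (i, i) ^ k)" for k .
  have "B ^\<^sub>m m = Q * A ^\<^sub>m m * P"
    using similar_mat_wit_pow_id[OF similar_mat_wit_sym[OF wit]] .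
  also have "\<dots> = 1\<^sub>m n" using PQ assms(2) by simp
  finally have "(B $$ (i, i)) ^ m = 1" if "i < n" for i
    using upper_triangular_pow[OF B(1,2), of m] that by simp
  then show ?thesis unfolding trace
    by (intro unity_sum_sum unity_sum_power) auto
qed

section \<open>Representations and virtual characters\<close>

lemma GL_simps:
  "mult (GL n) = (*)" "one (GL n) = 1\<^sub>m n" "carrier (GL n) \<subseteq> carrier_mat n n"
  by (auto simp: GL_def units_of_def Units_def ring_mat_simps)

lemma group_GL: "group (GL n)"
proof -
  interpret semiring "ring_mat TYPE(complex) n ()" by (rule semiring_mat)
  show ?thesis unfolding GL_def by (rule units_group)
qed

lemma GL_nat_pow:
  assumes "A \<in> carrier (GL n)"
  shows "A [^]\<^bsub>GL n\<^esub> (k::nat) = A ^\<^sub>m k"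
proof -
  have "dim_row A = n" using assms GL_simps(3) by blast
  then show ?thesis by (induction k) (auto simp: GL_simps nat_pow_def)
qed

lemma trace_rep_conj:
  assumes "group G" "\<rho> \<in> hom G (GL n)" "g \<in> carrier G" "h \<in> carrier G"
  shows "mat_trace (\<rho> (h \<otimes>\<^bsub>G\<^esub> g \<otimes>\<^bsub>G\<^esub> inv\<^bsub>G\<^esub> h)) = mat_trace (\<rho> g)"
proof -
  interpret group_hom G "GL n" \<rho>
    using assms group_GL by (simp add: group_hom_def group_hom_axioms_def)
  have C: "\<rho> g \<in> carrier_mat n n" "\<rho> h \<in> carrier_mat n n" "\<rho> (inv\<^bsub>G\<^esub> h) \<in> carrier_mat n n"
    using assms(3,4) hom_closed GL_simps(3) by blast+
  have "\<rho> (inv\<^bsub>G\<^esub> h) * \<rho> h = \<rho> (inv\<^bsub>G\<^esub> h \<otimes>\<^bsub>G\<^esub> h)"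
    using assms(3,4) by (subst hom_mult) (auto simp: GL_simps)
  also have "\<dots> = 1\<^sub>m n"
    using assms(4) hom_one by (simp add: GL_simps)
  finally have "mat_trace (\<rho> h * \<rho> g * \<rho> (inv\<^bsub>G\<^esub> h)) = mat_trace (\<rho> g)"
    using C by (intro mat_trace_conjugate) auto
  then show ?thesis using assms(3,4) by (simp add: GL_simps)
qed

lemma irreducible_character_class_function:
  assumes "group G" "\<phi> \<in> irreducible_characters G"
  shows "\<phi> \<in> class_functions G"
proof -
  interpret group G by fact
  obtain n \<rho> where "\<phi> = extend_fun G (\<lambda>g. mat_trace (\<rho> g))" "\<rho> \<in> hom G (GL n)"
    using assms(2) by (auto simp: irreducible_characters_def irreducible_rep_def)
  then show ?thesis
    using trace_rep_conj[OF assms(1)] by (auto simp: class_functions_def extend_fun_def)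
qed

lemma virtual_character_class_function:
  assumes "group G" "\<chi> \<in> virtual_characters G"
  shows "\<chi> \<in> class_functions G"
proof -
  obtain S and c :: "('a \<Rightarrow> complex) \<Rightarrow> int" where *: "\<chi> = (\<lambda>g. \<Sum>\<phi>\<in>S. of_int (c \<phi>) * \<phi> g)"
      "S \<subseteq> irreducible_characters G"
    using assms(2) by (auto simp: virtual_characters_def)
  then have "\<phi> \<in> class_functions G" if "\<phi> \<in> S" for \<phi>
    using irreducible_character_class_function[OF assms(1)] that by blast
  then show ?thesis unfolding * class_functions_def by (auto intro!: sum.cong)
qed

text \<open>By Lagrange \<open>g\<close> to the power \<open>|G|\<close> is the identity, so the
  trace lemma applies to each \<open>\<rho> g\<close> with the same modulus for all \<open>g\<close>
  and all characters.\<close>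

lemma virtual_character_unity_sum:
  assumes "group G" "finite (carrier G)" "\<chi> \<in> virtual_characters G" "g \<in> carrier G"
  shows "unity_sum (card (carrier G)) (\<lambda>k. \<chi> (g [^]\<^bsub>G\<^esub> k))"
proof -
  interpret G: group G by fact
  obtain S and c :: "('a \<Rightarrow> complex) \<Rightarrow> int" where *: "\<chi> = (\<lambda>g. \<Sum>\<phi>\<in>S. of_int (c \<phi>) * \<phi> g)"
      "S \<subseteq> irreducible_characters G"
    using assms(3) by (auto simp: virtual_characters_def)
  have "unity_sum (card (carrier G)) (\<lambda>k. \<phi> (g [^]\<^bsub>G\<^esub> k))" if \<phi>: "\<phi> \<in> S" for \<phi>
  proof -
    obtain n \<rho> where \<rho>: "\<phi> = extend_fun G (\<lambda>g. mat_trace (\<rho> g))" "\<rho> \<in> hom G (GL n)"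
      using subsetD[OF *(2) \<phi>] by (auto simp: irreducible_characters_def irreducible_rep_def)
    interpret group_hom G "GL n" \<rho>
      using assms \<rho> group_GL by (simp add: group_hom_def group_hom_axioms_def)
    have pow: "\<rho> (g [^]\<^bsub>G\<^esub> k) = \<rho> g ^\<^sub>m k" for k :: nat
      using hom_nat_pow[OF assms(4)] GL_nat_pow[OF hom_closed[OF assms(4)]] by simp
    have "\<rho> g ^\<^sub>m card (carrier G) = 1\<^sub>m n"
      using G.pow_order_eq_1[OF assms(4)] hom_one unfolding Coset.order_def by (simp add: GL_simps flip: pow)
    moreover have "\<rho> g \<in> carrier_mat n n"
      using hom_closed[OF assms(4)] GL_simps(3) by blast
    ultimately have "unity_sum (card (carrier G)) (\<lambda>k. mat_trace (\<rho> g ^\<^sub>m k))"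
      by (intro unity_sum_trace_pow)
    then show ?thesis using assms(4) by (simp add: \<rho>(1) extend_fun_def pow)
  qed
  then show ?thesis unfolding *
    by (intro unity_sum_sum unity_sum_mult unity_sum_of_int)
qed

section \<open>The necklace coordinates of \<open>\<lambda>\<^sub>t(\<chi>)\<close>\<close>

text \<open>Ensures that Adams operations keep class functions constant on conjugacy
  classes.\<close>

lemma (in group) conj_nat_pow:
  assumes "g \<in> carrier G" "h \<in> carrier G"
  shows "(h \<otimes> g \<otimes> inv h) [^] (n::nat) = h \<otimes> g [^] n \<otimes> inv h"
proof (induction n)
  case (Suc n)
  have "h \<otimes> g [^] n \<otimes> inv h \<otimes> (h \<otimes> g \<otimes> inv h) = h \<otimes> (g [^] n \<otimes> (inv h \<otimes> h) \<otimes> g) \<otimes> inv h"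
    using assms by (simp only: m_assoc m_closed nat_pow_closed inv_closed)
  then show ?case using Suc assms by simp
qed (use assms in simp)

text \<open>\<open>E_Nr\<close> is a definite description, so existence and uniqueness are both
  shown. The solution is found pointwise and is a class function because it depends on
  \<open>g\<close> only through its Adams sequence.\<close>

lemma E_Nr_lambda_t:
  assumes "group G" "f \<in> class_functions G"
  shows "E_Nr (class_functions G) (lambda_t G f) = (\<lambda>n g. divisor_inverse (\<lambda>k. adams G k f g) n)"
    (is "_ = ?a")
proof -
  interpret group G by fact
  let ?lim = "\<lambda>a. (\<lambda>n. \<Prod>i=1..n. one_minus_powr ((- fps_X) ^ i) (a i)) \<longlonglongrightarrow> lambda_t G f"
  have "(\<lambda>k. adams G k f (h \<otimes>\<^bsub>G\<^esub> g \<otimes>\<^bsub>G\<^esub> inv\<^bsub>G\<^esub> h)) = (\<lambda>k. adams G k f g)"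
    if "g \<in> carrier G" "h \<in> carrier G" for g h
    using that assms(2) by (auto simp: adams_def extend_fun_def conj_nat_pow class_functions_def)
  moreover have "(\<lambda>k. adams G k f g) = (\<lambda>k. adams G k f \<one>\<^bsub>G\<^esub>)" if "g \<notin> carrier G" for g
    using that by (simp add: adams_def extend_fun_def)
  ultimately have "?a n \<in> class_functions G" for n
    by (auto simp: class_functions_def)
  moreover have "?a 0 = 0" by (simp add: fun_eq_iff)
  ultimately have "?a \<in> carrier (necklace_ring (class_functions G))"
    by (auto simp: necklace_ring_def)
  moreover have "?lim ?a"
    unfolding necklace_product_tendsto_iff by (simp add: divisor_inverse_sum)
  moreover have "b = ?a" if "b \<in> carrier (necklace_ring (class_functions G))" "?lim b" for b
  proof (rule ext, rule ext)
    fix n g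
    show "b n g = ?a n g"
    proof (cases "n = 0")
      \<comment> \<open>The product never involves entry 0; membership in the necklace ring fixes
        it.\<close>
      case True
      then show ?thesis using that(1) by (simp add: necklace_ring_def)
    next
      case False
      have "b n g = divisor_inverse (\<lambda>k. adams G k f g) n"
      proof (rule divisor_sum_unique)
        show "(\<Sum>d | d dvd n. of_nat d * b d g) =
            (\<Sum>d | d dvd n. of_nat d * divisor_inverse (\<lambda>k. adams G k f g) d)" if "n \<ge> 1" for n
          using that \<open>?lim b\<close> unfolding necklace_product_tendsto_iff
          by (simp add: divisor_inverse_sum)
      qed (use False in simp)
      then show ?thesis .
    qed
  qed
  ultimately show ?thesis
    unfolding E_Nr_def by (intro the_equality conjI) (assumption | blast)+
qed

theorem mainTheorem3:
  fixes G :: "('a, 'b) monoid_scheme" and \<chi> :: "'a \<Rightarrow> complex"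
  assumes "group G" and "finite (carrier G)"
    and "\<chi> \<in> virtual_characters G"
  shows "integer_valued_character G \<chi> \<longleftrightarrow>
         finite_support (E_Nr (class_functions G) (lambda_t G \<chi>))"
proof -
  interpret group G by fact
  let ?m = "card (carrier G)"
  have m: "?m > 0" using assms(2) by (auto simp: card_gt_0_iff)
  note E = E_Nr_lambda_t[OF assms(1) virtual_character_class_function[OF assms(1,3)]]
  \<comment> \<open>Outside the carrier all values are those at the identity, so every point of the
    type is covered by some group element.\<close>
  have adams: "\<exists>h\<in>carrier G. (\<lambda>k. adams G k \<chi> g) = (\<lambda>k. \<chi> (h [^]\<^bsub>G\<^esub> k))" for g
  proof
    show "(if g \<in> carrier G then g else \<one>\<^bsub>G\<^esub>) \<in> carrier G" by simp
    show "(\<lambda>k. adams G k \<chi> g) = (\<lambda>k. \<chi> ((if g \<in> carrier G then g else \<one>\<^bsub>G\<^esub>) [^]\<^bsub>G\<^esub> k))"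
      by (auto simp: adams_def extend_fun_def)
  qed
  show ?thesis
  proof
    assume int: "integer_valued_character G \<chi>"
    have "divisor_inverse (\<lambda>k. adams G k \<chi> g) n = 0" if n: "n \<ge> 1" "\<not> n dvd ?m" for n g
    proof -
      obtain h where h: "h \<in> carrier G" "(\<lambda>k. adams G k \<chi> g) = (\<lambda>k. \<chi> (h [^]\<^bsub>G\<^esub> k))"
        using adams by blast
      have "\<chi> (h [^]\<^bsub>G\<^esub> k) \<in> \<int>" for k :: nat
        using int h(1) by (simp add: integer_valued_character_def)
      then obtain S where S: "\<And>k::nat. \<chi> (h [^]\<^bsub>G\<^esub> k) = of_int (S k)"
      proof -
        have "\<forall>k::nat. \<exists>c. \<chi> (h [^]\<^bsub>G\<^esub> k) = of_int c"
          using \<open>\<And>k. \<chi> (h [^]\<^bsub>G\<^esub> k) \<in> \<int>\<close> by (blast elim: Ints_cases)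
        from choice[OF this] show ?thesis using that by blast
      qed
      have "unity_sum ?m (\<lambda>k. of_int (S k))"
        using virtual_character_unity_sum[OF assms h(1)] by (simp add: S)
      note gcd = unity_sum_int_gcd[OF this m]
      show ?thesis
        unfolding h(2) S
      proof (rule divisor_inverse_eq_0[OF m _ n])
        show "of_int (S k) = (of_int (S (gcd k ?m)) :: complex)" for k
          by (rule arg_cong[OF gcd])
      qed
    qed
    then have "{n. n \<ge> 1 \<and> E_Nr (class_functions G) (lambda_t G \<chi>) n \<noteq> 0} \<subseteq> {n. n dvd ?m}"
      unfolding E by (auto simp: fun_eq_iff)
    then show "finite_support (E_Nr (class_functions G) (lambda_t G \<chi>))"
      unfolding finite_support_def by (rule finite_subset) (use m in simp)
  next
    assume "finite_support (E_Nr (class_functions G) (lambda_t G \<chi>))"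
    then obtain N where N: "n \<le> N" if "n \<ge> 1" "E_Nr (class_functions G) (lambda_t G \<chi>) n \<noteq> 0" for n
      unfolding finite_support_def finite_nat_set_iff_bounded_le by blast
    have "\<chi> g \<in> \<int>" if g: "g \<in> carrier G" for g
    proof -
      let ?s = "\<lambda>k::nat. \<chi> (g [^]\<^bsub>G\<^esub> k)"
      have s: "(\<lambda>k. adams G k \<chi> g) = ?s" using g by (simp add: adams_def extend_fun_def)
      have "divisor_inverse ?s 1 \<in> \<int>"
      proof (rule unity_sum_finite_divisor_support[OF virtual_character_unity_sum[OF assms g] m])
        show "divisor_inverse ?s d = 0" if "d > N" for d
        proof -
          have "(\<lambda>g. divisor_inverse (\<lambda>k. adams G k \<chi> g) d) = 0"
            using N[of d] that unfolding E by linarith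
          from fun_cong[OF this, of g] show ?thesis by (simp only: s zero_fun_apply)
        qed
        show "?s n = (\<Sum>d | d dvd n. of_nat d * divisor_inverse ?s d)" if "n \<ge> 1" for n
          by (rule divisor_inverse_sum[OF that, symmetric])
      qed simp
      \<comment> \<open>The divisor sum at 1 has the single term \<open>d = 1\<close>, so the first
        coordinate is the character value itself.\<close>
      moreover have "divisor_inverse ?s 1 = ?s 1"
        using divisor_inverse_sum[of 1 ?s] by simp
      ultimately show ?thesis using g by simp
    qed
    then show "integer_valued_character G \<chi>"
      using assms(3) by (simp add: integer_valued_character_def)
  qed
qed

end
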